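(* In the two-dimensional outcome setting (two independent binary events), there is no scoring rule $\mathbf{S}:\Delta\to\mathbb{R}^4$ that satisfies the technical conditions (continuity, differentiability, and quasiconcavity) and also satisfies the budget-constrained truthfulness property.
   Context: The outcome is a pair: the first component is Top ($T$) or Bottom ($B$), the second is Left ($L$) or Right ($R$), so the outcome set is $\Omega=\{TL,TR,BL,BR\}$. The events Top and Left are assumed independent; beliefs and reports are pairs $\mathbf{q}=(q_T,q_L)\in\Delta:=[0,1]\times[0,1]$. Write $\hat{\mathbf{q}}=(q_Tq_L,\;q_T(1-q_L),\;(1-q_T)q_L,\;(1-q_T)(1-q_L))$ for the induced probabilities of $(TL,TR,BL,BR)$. Mixtures $\alpha\mathbf{p}+(1-\alpha)\mathbf{q}$ are taken in $\Delta$, i.e. of the pairs. A scoring rule is an arbitrary map $\mathbf{S}=(S_{TL},S_{TR},S_{BL},S_{BR}):\Delta\to\mathbb{R}^4$ (not assumed separable across dimensions); an agent with belief $\mathbf{p}$ reporting $\mathbf{q}$ has expected score $\hat{\mathbf{p}}\cdot\mathbf{S}(\mathbf{q})$. Technical conditions: $\mathbf{S}$ is continuous and differentiable on the interior of $\Delta$; and (quasiconcavity) for each $\omega\in\Omega$ and all $\mathbf{p},\mathbf{q}\in\Delta$, $S_\omega(0.5\mathbf{p}+0.5\mathbf{q})\ge\min(S_\omega(\mathbf{p}),S_\omega(\mathbf{q}))$, with equality only if $S_\omega(\mathbf{p})=S_\omega(\mathbf{q})$. Natural budget: $\mathrm{nb}(\overline{\mathbf{q}},\mathbf{q})=\max_{\omega\in\Omega}[S_\omega(\overline{\mathbf{q}})-S_\omega(\mathbf{q})]$.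 The budget-constrained optimal report $\mathbf{q}^*(\mathbf{p},\overline{\mathbf{q}},b)$ is the unique maximizer of $\hat{\mathbf{p}}\cdot\mathbf{S}(\mathbf{q})$ among all $\mathbf{q}\in\Delta$ with $\mathrm{nb}(\overline{\mathbf{q}},\mathbf{q})\le b$. Budget-constrained truthfulness property: for all $\mathbf{p},\overline{\mathbf{q}}\in\Delta$ and all $b>0$, this unique maximizer exists and equals $\alpha\mathbf{p}+(1-\alpha)\overline{\mathbf{q}}$, where $\alpha=\max\{\alpha\in[0,1]:\mathrm{nb}(\overline{\mathbf{q}},\alpha\mathbf{p}+(1-\alpha)\overline{\mathbf{q}})\le b\}$. (In particular $\mathbf{S}$ is strictly proper: for each $\mathbf{p}\in\Delta$, $\mathbf{q}=\mathbf{p}$ is the unique maximizer of $\hat{\mathbf{p}}\cdot\mathbf{S}(\mathbf{q})$.) *)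

theory Defs
  imports "HOL-Analysis.Analysis"
begin

datatype outcome = TL | TR | BL | BR

lemma UNIV_outcome: "(UNIV :: outcome set) = {TL, TR, BL, BR}"
  by (auto intro: outcome.exhaust)

instance outcome :: finite
  by standard (simp add: UNIV_outcome)

text \<open>A belief or report is the pair of marginal probabilities of Top and Left.\<close>

definition belief_set :: "(real \<times> real) set" where
  "belief_set = {0..1} \<times> {0..1}"

definition joint_prob :: "real \<times> real \<Rightarrow> real ^ outcome" where
  "joint_prob q = (\<chi> \<omega>. case \<omega> of
      TL \<Rightarrow> fst q * snd q
    | TR \<Rightarrow> fst q * (1 - snd q)
    | BL \<Rightarrow> (1 - fst q) * snd q
    | BR \<Rightarrow> (1 - fst q) * (1 - snd q))"

text \<open>A scoring rule is a function on the whole type \<^typ>\<open>real \<times> real\<close>, of which only the values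
  on \<^const>\<open>belief_set\<close> are constrained or used.\<close>

type_synonym scoring_rule = "real \<times> real \<Rightarrow> real ^ outcome"

definition expected_score :: "scoring_rule \<Rightarrow> real \<times> real \<Rightarrow> real \<times> real \<Rightarrow> real" where
  "expected_score S p q = joint_prob p \<bullet> S q"

definition midpoint_quasiconcave :: "scoring_rule \<Rightarrow> bool" where
  "midpoint_quasiconcave S \<longleftrightarrow>
    (\<forall>\<omega>. \<forall>p\<in>belief_set. \<forall>q\<in>belief_set.
      S ((1/2) *\<^sub>R p + (1/2) *\<^sub>R q) $ \<omega> \<ge> min (S p $ \<omega>) (S q $ \<omega>) \<and>
      (S ((1/2) *\<^sub>R p + (1/2) *\<^sub>R q) $ \<omega> = min (S p $ \<omega>) (S q $ \<omega>) \<longrightarrow> S p $ \<omega> = S q $ \<omega>))"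

text \<open>Both continuity and differentiability are required on the interior only; nothing is assumed
  about continuity at the boundary of \<^const>\<open>belief_set\<close>.\<close>

definition technical_conditions :: "scoring_rule \<Rightarrow> bool" where
  "technical_conditions S \<longleftrightarrow>
    continuous_on (interior belief_set) S \<and>
    S differentiable_on interior belief_set \<and>
    midpoint_quasiconcave S"

definition natural_budget :: "scoring_rule \<Rightarrow> real \<times> real \<Rightarrow> real \<times> real \<Rightarrow> real" where
  "natural_budget S qbar q = (MAX \<omega>. S qbar $ \<omega> - S q $ \<omega>)"

definition optimal_report ::
    "scoring_rule \<Rightarrow> real \<times> real \<Rightarrow> real \<times> real \<Rightarrow> real \<Rightarrow> real \<times> real \<Rightarrow> bool" where
  "optimal_report S p qbar b q \<longleftrightarrow>
    is_arg_max (expected_score S p) (\<lambda>r. r \<in> belief_set \<and> natural_budget S qbar r \<le> b) q"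

definition feasible_weights ::
    "scoring_rule \<Rightarrow> real \<times> real \<Rightarrow> real \<times> real \<Rightarrow> real \<Rightarrow> real set" where
  "feasible_weights S p qbar b =
    {\<alpha> \<in> {0..1}. natural_budget S qbar (\<alpha> *\<^sub>R p + (1 - \<alpha>) *\<^sub>R qbar) \<le> b}"

text \<open>The maximum of \<^const>\<open>feasible_weights\<close> is expressed relationally, since \<^const>\<open>Max\<close> is
  meaningful for finite sets only. The property includes that this maximum is attained.\<close>

definition budget_constrained_truthful :: "scoring_rule \<Rightarrow> bool" where
  "budget_constrained_truthful S \<longleftrightarrow>
    (\<forall>p\<in>belief_set. \<forall>qbar\<in>belief_set. \<forall>b>0.
      (\<exists>!q. optimal_report S p qbar b q) \<and>
      (\<exists>\<alpha>. \<alpha> \<in> feasible_weights S p qbar b \<and>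
           (\<forall>\<beta>\<in>feasible_weights S p qbar b. \<beta> \<le> \<alpha>) \<and>
           optimal_report S p qbar b (\<alpha> *\<^sub>R p + (1 - \<alpha>) *\<^sub>R qbar)))"

end

theory Submission
  imports Defs
begin

text \<open>
  Fix an interior report \<open>q\<close> off the two diagonals of the square and let \<open>g \<omega>\<close> be the gradient of
  \<open>S \<omega>\<close> at \<open>q\<close>. Starting close to \<open>q\<close> and moving towards a belief \<open>p\<close> beyond \<open>q\<close>, with a budget
  that is exhausted at \<open>q\<close>, the binding outcomes are among the minimizers of \<open>g \<omega> \<bullet> (p - q)\<close>, so the
  gradient of the expected score under \<open>p\<close> cannot have positive product with a direction that
  raises the score of all these outcomes.

  If \<open>v\<close> is a longest \<open>g \<omega>\<close>, it is the only minimizing gradient for all \<open>p\<close> near \<open>q - t v\<close>. So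
  the component of the expected gradient orthogonal to \<open>v\<close>, which is bilinear in \<open>p\<close>, vanishes on an
  open set, hence identically, and \<open>g \<omega> = c \<omega> v\<close> for all \<open>\<omega>\<close>. The same condition, applied on both
  sides of the line \<open>L\<close> through \<open>q\<close> orthogonal to \<open>v\<close>, shows that the expectation of \<open>c\<close> under
  every belief on \<open>L\<close> is zero.
  Unless \<open>c = 0\<close>, this forces \<open>L\<close> to leave the square at a point \<open>p\<close> such that \<open>c \<omega> \<noteq> 0\<close> for
  all outcomes that are possible under \<open>p\<close>. By quasiconcavity the scores of these outcomes are
  maximal at \<open>q\<close> along \<open>L\<close>, so an agent with belief \<open>p\<close> does not gain by moving from \<open>q\<close>
  towards \<open>p\<close>, against budget-constrained truthfulness.

  Hence the derivative of \<open>S\<close> vanishes off the diagonals, and \<open>S\<close> is constant on a segment, which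
  contradicts strict properness.
\<close>

section \<open>The belief square, outcome probabilities and the natural budget\<close>

lemma interior_belief_set: "interior belief_set = {0<..<1} \<times> {0<..<1}"
  by (simp add: belief_set_def interior_Times)

lemma interior_belief_setD: "q \<in> interior belief_set \<Longrightarrow> q \<in> belief_set"
  using interior_subset by blast

lemma convex_belief_set: "convex belief_set"
  by (simp add: belief_set_def convex_Times)

lemma mix_in_belief_set:
  assumes "p \<in> belief_set" "q \<in> belief_set" "0 \<le> a" "a \<le> 1"
  shows "a *\<^sub>R p + (1 - a) *\<^sub>R q \<in> belief_set"
  using convex_belief_set assms by (simp add: convex_def)

lemma mix_in_interior_belief_set:
  assumes "p \<in> belief_set" "q \<in> interior belief_set" "0 \<le> a" "a < 1"
  shows "a *\<^sub>R p + (1 - a) *\<^sub>R q \<in> interior belief_set"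
  using mem_interior_convex_shrink[OF convex_belief_set assms(2,1), of "1 - a"] assms(3,4)
  by (simp add: algebra_simps)

lemma joint_prob_nth:
  "joint_prob q $ TL = fst q * snd q"
  "joint_prob q $ TR = fst q * (1 - snd q)"
  "joint_prob q $ BL = (1 - fst q) * snd q"
  "joint_prob q $ BR = (1 - fst q) * (1 - snd q)"
  by (simp_all add: joint_prob_def)

lemma sum_outcome: "(\<Sum>\<omega>\<in>UNIV. f \<omega>) = f TL + f TR + f BL + f BR"
  by (simp add: UNIV_outcome add.assoc)

lemma joint_prob_nonneg: "q \<in> belief_set \<Longrightarrow> 0 \<le> joint_prob q $ \<omega>"
  by (cases \<omega>) (auto simp: joint_prob_nth belief_set_def)

lemma joint_prob_pos: "q \<in> interior belief_set \<Longrightarrow> 0 < joint_prob q $ \<omega>"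
  by (cases \<omega>) (auto simp: joint_prob_nth interior_belief_set)

lemma expected_score_sum: "expected_score S p q = (\<Sum>\<omega>\<in>UNIV. joint_prob p $ \<omega> * S q $ \<omega>)"
  by (simp add: expected_score_def inner_vec_def)

lemma natural_budget_le_iff: "natural_budget S a q \<le> b \<longleftrightarrow> (\<forall>\<omega>. S a $ \<omega> - S q $ \<omega> \<le> b)"
  by (simp add: natural_budget_def)

lemma natural_budget_less_iff: "natural_budget S a q < b \<longleftrightarrow> (\<forall>\<omega>. S a $ \<omega> - S q $ \<omega> < b)"
  by (simp add: natural_budget_def)

lemma natural_budget_ge: "S a $ \<omega> - S q $ \<omega> \<le> natural_budget S a q"
  using natural_budget_le_iff by blast

lemma natural_budget_attained: "\<exists>\<omega>. S a $ \<omega> - S q $ \<omega> = natural_budget S a q"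
  by (meson natural_budget_ge natural_budget_less_iff order.irrefl order.order_iff_strict)

lemma natural_budget_eq_max: "natural_budget S a q =
   max (max (S a $ TL - S q $ TL) (S a $ TR - S q $ TR)) (max (S a $ BL - S q $ BL) (S a $ BR - S q $ BR))"
  by (simp add: natural_budget_def UNIV_outcome max.assoc)

section \<open>Bilinear polynomials and directional derivatives\<close>

text \<open>The mixed second difference over the four corners isolates \<open>e\<close>; first
  differences then isolate \<open>b\<close> and \<open>c\<close>.\<close>

lemma bilinear_eq_0:
  fixes a b c e x y h :: real
  assumes "h \<noteq> 0"
    and z: "\<And>s t. s \<in> {0, h} \<Longrightarrow> t \<in> {0, h} \<Longrightarrow> a + b * (x + s) + c * (y + t) + e * ((x + s) * (y + t)) = 0"
  shows "a = 0" "b = 0" "c = 0" "e = 0"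
proof -
  note z00 = z[of 0 0] and zh0 = z[of h 0] and z0h = z[of 0 h] and zhh = z[of h h]
  have "e * (h * h) = 0"
    using z00[simplified] zh0[simplified] z0h[simplified] zhh[simplified] by algebra
  then show e: "e = 0" using \<open>h \<noteq> 0\<close> by simp
  have "b * h = 0"
    using z00[simplified] zh0[simplified] e by algebra
  moreover have "c * h = 0"
    using z00[simplified] z0h[simplified] e by algebra
  ultimately show "b = 0" "c = 0" using \<open>h \<noteq> 0\<close> by simp_all
  with z00 e show "a = 0" by simp
qed

lemma eventually_increasing_along:
  fixes f :: "'a::real_inner \<Rightarrow> real"
  assumes "(f has_derivative (\<lambda>h. g \<bullet> h)) (at q)" "g \<bullet> e > 0"
  shows "\<forall>\<^sub>F t in at_right 0. f (q + t *\<^sub>R e) > f q"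
proof -
  have "((\<lambda>t. q + t *\<^sub>R e) has_derivative (\<lambda>t. t *\<^sub>R e)) (at 0)"
    by (auto intro!: derivative_eq_intros)
  moreover have "(f has_derivative (\<lambda>h. g \<bullet> h)) (at (q + 0 *\<^sub>R e))"
    using assms by simp
  ultimately have "((\<lambda>t. f (q + t *\<^sub>R e)) has_derivative (\<lambda>t. g \<bullet> (t *\<^sub>R e))) (at 0)"
    by (rule has_derivative_compose)
  then have "((\<lambda>t. f (q + t *\<^sub>R e)) has_real_derivative (g \<bullet> e)) (at 0)"
    by (simp add: has_field_derivative_def mult.commute[of "g \<bullet> e"] fun_eq_iff)
       (metis (no_types, lifting) ext mult.commute)
  from DERIV_pos_inc_right[OF this assms(2)]
  obtain d where "d > 0" "\<And>h. h > 0 \<Longrightarrow> h < d \<Longrightarrow> f q < f (q + h *\<^sub>R e)"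
    by auto
  then show ?thesis
    by (auto simp: eventually_at_right_field)
qed

lemma eventually_along_line:
  fixes q :: "'a::real_normed_vector"
  assumes "open U" "q \<in> U"
  shows "\<forall>\<^sub>F t::real in at_right 0. q + t *\<^sub>R e \<in> U"
proof -
  have "((\<lambda>t::real. q + t *\<^sub>R e) \<longlongrightarrow> q + 0 *\<^sub>R e) (at_right 0)"
    by (intro tendsto_intros)
  then show ?thesis
    using assms by (intro topological_tendstoD) auto
qed

section \<open>Strict properness and the budget along segments\<close>

locale truthful_rule =
  fixes S :: scoring_rule
  assumes technical: "technical_conditions S"
    and truthful: "budget_constrained_truthful S"
begin

lemma quasiconcave:
  assumes "p \<in> belief_set" "q \<in> belief_set"
  shows "S ((1/2) *\<^sub>R p + (1/2) *\<^sub>R q) $ \<omega> \<ge> min (S p $ \<omega>) (S q $ \<omega>)"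
    and "S p $ \<omega> \<noteq> S q $ \<omega> \<Longrightarrow> S ((1/2) *\<^sub>R p + (1/2) *\<^sub>R q) $ \<omega> > min (S p $ \<omega>) (S q $ \<omega>)"
  using technical assms unfolding technical_conditions_def midpoint_quasiconcave_def
  by (blast, metis order.order_iff_strict)

lemma isCont_S: "q \<in> interior belief_set \<Longrightarrow> isCont S q"
  using technical unfolding technical_conditions_def
  by (simp add: continuous_on_eq_continuous_at)

lemma optimal_report_strict:
  assumes "optimal_report S p a b q" "p \<in> belief_set" "a \<in> belief_set" "b > 0"
    and "r \<in> belief_set" "natural_budget S a r \<le> b" "r \<noteq> q"
  shows "expected_score S p r < expected_score S p q"
proof (rule ccontr)
  assume "\<not> ?thesis"
  then have "optimal_report S p a b r"
    using assms unfolding optimal_report_def is_arg_max_linorder by fastforce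
  moreover have "\<exists>!q. optimal_report S p a b q"
    using truthful assms unfolding budget_constrained_truthful_def by blast
  ultimately show False using assms by blast
qed

text \<open>If the starting report equals the belief, every mixture collapses to it, so it is
  optimal under any positive budget. The budget is taken large enough to admit
  \<open>r\<close>.\<close>

lemma strictly_proper:
  assumes "q \<in> belief_set" "r \<in> belief_set" "r \<noteq> q"
  shows "expected_score S q r < expected_score S q q"
proof -
  define b where "b = max 1 (natural_budget S q r)"
  obtain a where "optimal_report S q q b (a *\<^sub>R q + (1 - a) *\<^sub>R q)"
    using truthful assms unfolding budget_constrained_truthful_def b_def
    by (metis less_max_iff_disj zero_less_one)
  then have "optimal_report S q q b q" by (simp add: algebra_simps)
  then show ?thesis
    using optimal_report_strict[of q q b q r] assms by (simp add: b_def)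
qed

text \<open>If no outcome scored less at \<open>r\<close> than at \<open>q\<close>, an agent with
  belief \<open>q\<close> would be at least as well off reporting \<open>r\<close>.\<close>

lemma natural_budget_pos:
  assumes "q \<in> belief_set" "r \<in> belief_set" "r \<noteq> q"
  shows "natural_budget S q r > 0"
proof (rule ccontr)
  assume "\<not> ?thesis"
  then have "\<And>\<omega>. S q $ \<omega> \<le> S r $ \<omega>"
    using natural_budget_le_iff[of S q r 0] by simp
  then have "expected_score S q q \<le> expected_score S q r"
    unfolding expected_score_sum
    by (intro sum_mono mult_left_mono joint_prob_nonneg assms) auto
  then show False using strictly_proper[OF assms] by simp
qed

text \<open>An outcome with different scores at the endpoints scores strictly above their minimum at
  the midpoint; one with equal scores loses nothing there, while the budget for \<open>p\<close> is
  positive.\<close>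

lemma natural_budget_midpoint_less:
  assumes "q \<in> belief_set" "p \<in> belief_set" "p \<noteq> q"
  shows "natural_budget S q ((1/2) *\<^sub>R p + (1/2) *\<^sub>R q) < natural_budget S q p"
  unfolding natural_budget_less_iff
proof
  fix \<omega>
  show "S q $ \<omega> - S ((1/2) *\<^sub>R p + (1/2) *\<^sub>R q) $ \<omega> < natural_budget S q p"
    using quasiconcave[OF assms(2,1), of \<omega>] natural_budget_pos[OF assms(1,2,3)]
      natural_budget_ge[of S q \<omega> p] by linarith
qed

lemma continuous_on_natural_budget:
  "continuous_on (interior belief_set) (natural_budget S a)"
proof -
  have "continuous_on (interior belief_set) S"
    using technical by (simp add: technical_conditions_def)
  then show ?thesis
    unfolding natural_budget_eq_max by (intro continuous_intros)
qed

text \<open>On \<open>[0, t]\<close> the budget is continuous and has a smallest maximizer. Once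
  this is shown to be \<open>t\<close>, every earlier weight costs strictly less.\<close>

lemma natural_budget_strict_mono:
  assumes a: "a \<in> interior belief_set" and p: "p \<in> interior belief_set" and "p \<noteq> a"
    and st: "0 \<le> s" "s < t" "t \<le> 1"
  shows "natural_budget S a (s *\<^sub>R p + (1 - s) *\<^sub>R a) < natural_budget S a (t *\<^sub>R p + (1 - t) *\<^sub>R a)"
proof -
  define l where "l u = u *\<^sub>R p + (1 - u) *\<^sub>R a" for u
  define f where "f u = natural_budget S a (l u)" for u
  have l: "l u \<in> interior belief_set" if "0 \<le> u" "u \<le> 1" for u
    using convex_interior[OF convex_belief_set] a p that by (simp add: convex_def l_def)
  have cont: "continuous_on {0..t} f"
    unfolding f_def
    by (rule continuous_on_compose2[OF continuous_on_natural_budget, of _ l])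
       (use l st in \<open>auto simp: l_def intro!: continuous_intros\<close>)
  obtain m where m: "m \<in> {0..t}" "\<And>u. u \<in> {0..t} \<Longrightarrow> f u \<le> f m"
    using continuous_attains_sup[OF _ _ cont] st by auto
  define A where "A = {0..t} \<inter> f -` {f m}"
  have "compact A"
    using continuous_closed_preimage[OF cont, of "{f m}"] unfolding A_def compact_eq_bounded_closed
    by (auto intro: bounded_Int)
  moreover have "A \<noteq> {}" using m by (auto simp: A_def)
  ultimately obtain k where k: "k \<in> A" "\<And>u. u \<in> A \<Longrightarrow> k \<le> u"
    using compact_attains_inf[of A] by auto
  have f0: "f 0 = 0"
    by (simp add: f_def l_def natural_budget_eq_max)
  have lne: "l u \<noteq> a" if "u > 0" for u
  proof
    assume "l u = a"
    then have "u *\<^sub>R (p - a) = 0" by (simp add: l_def algebra_simps)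
    then show False using that \<open>p \<noteq> a\<close> by simp
  qed
  have "f t > 0"
    unfolding f_def using st by (intro natural_budget_pos interior_belief_setD a l lne) auto
  have fk: "f k = f m" "0 \<le> k" "k \<le> t" using k(1) by (simp_all add: A_def)
  have "f t \<le> f m" using m(2)[of t] st by simp
  then have "k \<noteq> 0" using fk(1) f0 \<open>f t > 0\<close> by auto
  txt \<open>A smallest maximizer \<open>k < t\<close> would be the midpoint of two points with values at most \<open>f k\<close>,
    and semistrict quasiconcavity would make the left one a smaller maximizer.\<close>
  have "k = t"
  proof (rule ccontr)
    assume "k \<noteq> t"
    define h where "h = min k (t - k)"
    have h: "h > 0" "h \<le> k" "k + h \<le> t"
      using fk \<open>k \<noteq> t\<close> \<open>k \<noteq> 0\<close> by (simp_all add: h_def)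
    have bd: "0 \<le> k - h" "k - h \<le> t" "0 \<le> k + h"
      using h fk by simp_all
    obtain \<omega> where \<omega>: "S a $ \<omega> - S (l k) $ \<omega> = f k"
      using natural_budget_attained unfolding f_def by blast
    have mid: "l k = (1/2) *\<^sub>R l (k - h) + (1/2) *\<^sub>R l (k + h)"
      by (simp add: l_def prod_eq_iff field_simps)
    have "f (k - h) \<le> f k" "f (k + h) \<le> f k"
      using m(2)[of "k - h"] m(2)[of "k + h"] fk h bd by simp_all
    moreover have "S a $ \<omega> - S (l (k - h)) $ \<omega> \<le> f (k - h)" "S a $ \<omega> - S (l (k + h)) $ \<omega> \<le> f (k + h)"
      by (simp_all add: f_def natural_budget_ge)
    moreover have "l (k - h) \<in> belief_set" "l (k + h) \<in> belief_set"
      using l bd h st by (auto intro!: interior_belief_setD)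
    note quasiconcave[OF this, of \<omega>, folded mid]
    ultimately have "f (k - h) = f k" using \<omega> by linarith
    then have "k - h \<in> A" using fk bd by (simp add: A_def)
    then show False using k(2)[of "k - h"] h by simp
  qed
  have "s \<notin> A" using k(2)[of s] \<open>k = t\<close> st by auto
  then have "f s \<noteq> f m" using st by (simp add: A_def)
  then have "f s < f t"
    using m(2)[of s] st fk \<open>k = t\<close> by simp
  then show ?thesis by (simp add: f_def l_def)
qed

text \<open>Under the budget that is exhausted exactly at \<open>q\<close>, strict monotonicity
  leaves no feasible weight above \<open>s\<close>, so the report prescribed by truthfulness is
  \<open>q\<close>.\<close>

lemma optimal_on_ray:
  assumes a: "a \<in> interior belief_set" and p: "p \<in> interior belief_set" and "p \<noteq> a"
    and s: "0 < s" "s \<le> 1" and q: "q = s *\<^sub>R p + (1 - s) *\<^sub>R a"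
    and r: "r \<in> belief_set" "natural_budget S a r \<le> natural_budget S a q"
  shows "expected_score S p r \<le> expected_score S p q"
proof -
  define b where "b = natural_budget S a q"
  have "q - a = s *\<^sub>R (p - a)" by (simp add: q algebra_simps)
  then have "q \<noteq> a" using \<open>p \<noteq> a\<close> s by auto
  moreover have "q \<in> belief_set"
    unfolding q using a p s by (intro mix_in_belief_set interior_belief_setD) auto
  ultimately have "b > 0"
    using a by (auto simp: b_def intro!: natural_budget_pos interior_belief_setD)
  then obtain t where t: "t \<in> feasible_weights S p a b" "\<forall>u\<in>feasible_weights S p a b. u \<le> t"
      "optimal_report S p a b (t *\<^sub>R p + (1 - t) *\<^sub>R a)"
    using truthful a p interior_belief_setD unfolding budget_constrained_truthful_def by blast
  have "s \<in> feasible_weights S p a b"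
    using s by (simp add: feasible_weights_def b_def q)
  then have "s \<le> t" using t by blast
  moreover have "\<not> s < t"
    using natural_budget_strict_mono[OF a p \<open>p \<noteq> a\<close>, of s t] t(1) s
    by (auto simp: feasible_weights_def b_def q)
  ultimately have "optimal_report S p a b q" using t(3) q by simp
  then show ?thesis
    using r unfolding optimal_report_def is_arg_max_linorder b_def by blast
qed

text \<open>Here \<open>p\<close> may lie on the boundary, where \<open>S\<close> need not be continuous. The budget needed
  for the midpoint does not suffice for \<open>p\<close> itself, which gives \<open>t < 1\<close>.\<close>

lemma better_on_segment:
  assumes q: "q \<in> belief_set" and p: "p \<in> belief_set" and "p \<noteq> q"
  obtains t where "0 < t" "t < 1" "expected_score S p q < expected_score S p (t *\<^sub>R p + (1 - t) *\<^sub>R q)"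
proof -
  define b where "b = natural_budget S q ((1/2) *\<^sub>R p + (1/2) *\<^sub>R q)"
  define z where "z = (1/2) *\<^sub>R p + (1/2) *\<^sub>R q"
  have ne: "t *\<^sub>R p + (1 - t) *\<^sub>R q \<noteq> q" if "t \<noteq> 0" for t
  proof
    assume "t *\<^sub>R p + (1 - t) *\<^sub>R q = q"
    then have "t *\<^sub>R (p - q) = 0" by (simp add: algebra_simps)
    then show False using that \<open>p \<noteq> q\<close> by simp
  qed
  have "b > 0"
    unfolding b_def using ne[of "1/2"] mix_in_belief_set[OF p q, of "1/2"] q
    by (intro natural_budget_pos) auto
  then obtain t where t: "t \<in> feasible_weights S p q b" "\<forall>u\<in>feasible_weights S p q b. u \<le> t"
      "optimal_report S p q b (t *\<^sub>R p + (1 - t) *\<^sub>R q)"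
    using truthful q p unfolding budget_constrained_truthful_def by blast
  have "1/2 \<in> feasible_weights S p q b"
    by (simp add: feasible_weights_def b_def)
  then have "t \<ge> 1/2" using t by blast
  have "t \<noteq> 1"
    using natural_budget_midpoint_less[OF q p \<open>p \<noteq> q\<close>] t(1)
    by (auto simp: feasible_weights_def b_def)
  have "natural_budget S q q = 0" by (simp add: natural_budget_eq_max)
  then have "expected_score S p q < expected_score S p (t *\<^sub>R p + (1 - t) *\<^sub>R q)"
    using optimal_report_strict[OF t(3) p q \<open>b > 0\<close> q] ne[of t] \<open>b > 0\<close> \<open>t \<ge> 1/2\<close> by auto
  moreover have "t < 1" using t(1) \<open>t \<noteq> 1\<close> by (auto simp: feasible_weights_def)
  ultimately show ?thesis using that[of t] \<open>t \<ge> 1/2\<close> by auto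
qed

section \<open>Gradients at an interior report\<close>

text \<open>Otherwise a short step from \<open>q\<close> along \<open>e\<close> would raise the
  expected score and still respect the budget spent at \<open>q\<close>, contradicting optimality of
  \<open>q\<close>.\<close>

lemma first_order_condition:
  fixes g :: "outcome \<Rightarrow> real \<times> real"
  assumes q: "q \<in> interior belief_set" and p: "p \<in> interior belief_set" and "p \<noteq> q"
    and g: "\<And>\<omega>. ((\<lambda>r. S r $ \<omega>) has_derivative (\<lambda>h. g \<omega> \<bullet> h)) (at q)"
    and e: "\<And>\<omega>. (\<And>\<omega>'. g \<omega> \<bullet> (p - q) \<le> g \<omega>' \<bullet> (p - q)) \<Longrightarrow> g \<omega> \<bullet> e > 0"
  shows "(\<Sum>\<omega>\<in>UNIV. joint_prob p $ \<omega> * (g \<omega> \<bullet> e)) \<le> 0"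
proof (rule ccontr)
  assume neg: "\<not> ?thesis"
  \<comment> \<open>To first order, these are the outcomes that lose most on the way to
    \<open>q\<close> from a point beyond it.\<close>
  define A where "A = {\<omega>. \<forall>\<omega>'. g \<omega> \<bullet> (p - q) \<le> g \<omega>' \<bullet> (p - q)}"
  obtain \<omega>0 where "\<omega>0 \<in> A"
    using ex_min_if_finite[of "range (\<lambda>\<omega>. g \<omega> \<bullet> (p - q))"]
    by (auto simp: A_def not_less)
  have "\<forall>\<^sub>F t in at_right 0. S (q + t *\<^sub>R (q - p)) $ \<omega> - S q $ \<omega>
          < S (q + t *\<^sub>R (q - p)) $ \<omega>0 - S q $ \<omega>0" if "\<omega> \<notin> A" for \<omega>
  proof -
    have "((\<lambda>r. S r $ \<omega>0 - S r $ \<omega>) has_derivative (\<lambda>h. (g \<omega>0 - g \<omega>) \<bullet> h)) (at q)"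
      using has_derivative_diff[OF g g] by (simp add: inner_diff_left)
    moreover have "g \<omega>0 \<bullet> (p - q) < g \<omega> \<bullet> (p - q)"
      using that \<open>\<omega>0 \<in> A\<close> unfolding A_def by (smt (verit) mem_Collect_eq)
    then have "(g \<omega>0 - g \<omega>) \<bullet> (q - p) > 0"
      by (simp add: inner_diff_left inner_diff_right)
    ultimately have "\<forall>\<^sub>F t in at_right 0. S q $ \<omega>0 - S q $ \<omega>
       < S (q + t *\<^sub>R (q - p)) $ \<omega>0 - S (q + t *\<^sub>R (q - p)) $ \<omega>"
      using eventually_increasing_along by fast
    then show ?thesis by eventually_elim simp
  qed
  then have "\<forall>\<^sub>F t in at_right 0. \<forall>\<omega>\<in>-A. S (q + t *\<^sub>R (q - p)) $ \<omega> - S q $ \<omega>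
          < S (q + t *\<^sub>R (q - p)) $ \<omega>0 - S q $ \<omega>0"
    by (intro eventually_ball_finite) auto
  moreover have "\<forall>\<^sub>F t in at_right 0. q + t *\<^sub>R (q - p) \<in> interior belief_set"
    using q by (intro eventually_along_line) auto
  moreover have "\<forall>\<^sub>F t::real in at_right 0. t > 0"
    by (rule eventually_at_right_less)
  ultimately have "\<forall>\<^sub>F t in at_right 0. t > 0 \<and> q + t *\<^sub>R (q - p) \<in> interior belief_set \<and>
     (\<forall>\<omega>\<in>-A. S (q + t *\<^sub>R (q - p)) $ \<omega> - S q $ \<omega> < S (q + t *\<^sub>R (q - p)) $ \<omega>0 - S q $ \<omega>0)"
    by eventually_elim blast
  then obtain t where t: "t > 0" "q + t *\<^sub>R (q - p) \<in> interior belief_set"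
     "\<And>\<omega>. \<omega> \<notin> A \<Longrightarrow> S (q + t *\<^sub>R (q - p)) $ \<omega> - S q $ \<omega> < S (q + t *\<^sub>R (q - p)) $ \<omega>0 - S q $ \<omega>0"
    using eventually_happens'[OF trivial_limit_at_right_real] by (metis (no_types, lifting) ComplI)
  \<comment> \<open>Seen from \<open>p\<close>, the starting report \<open>a\<close> lies just
    beyond \<open>q\<close>, so \<open>q\<close> is on the segment from \<open>a\<close> to
    \<open>p\<close>.\<close>
  define a where "a = q + t *\<^sub>R (q - p)"
  define b where "b = natural_budget S a q"
  \<comment> \<open>Outcomes in \<open>A\<close> gain along \<open>e\<close>; all others have strict
    slack at \<open>q\<close>, which survives small steps by continuity.\<close>
  have "\<forall>\<^sub>F s in at_right 0. S a $ \<omega> - S (q + s *\<^sub>R e) $ \<omega> < b" for \<omega>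
  proof (cases "\<omega> \<in> A")
    case True
    then have "g \<omega> \<bullet> e > 0" using e by (simp add: A_def)
    from eventually_increasing_along[OF g this] show ?thesis
    proof eventually_elim
      case (elim s)
      then show ?case using natural_budget_ge[of S a \<omega> q] by (simp add: b_def)
    qed
  next
    case False
    have "S a $ \<omega> - S q $ \<omega> < b"
      using t(3)[OF False] natural_budget_ge[of S a \<omega>0 q] by (simp add: b_def a_def)
    moreover have "((\<lambda>s. S (q + s *\<^sub>R e)) \<longlongrightarrow> S q) (at_right 0)"
    proof (rule isCont_tendsto_compose[OF isCont_S[OF q]])
      have "((\<lambda>s. q + s *\<^sub>R e) \<longlongrightarrow> q + 0 *\<^sub>R e) (at_right 0)"
        by (intro tendsto_intros)
      then show "((\<lambda>s. q + s *\<^sub>R e) \<longlongrightarrow> q) (at_right 0)" by simp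
    qed
    then have "((\<lambda>s. S a $ \<omega> - S (q + s *\<^sub>R e) $ \<omega>) \<longlongrightarrow> S a $ \<omega> - S q $ \<omega>) (at_right 0)"
      by (intro tendsto_intros)
    ultimately show ?thesis by (auto dest: order_tendstoD)
  qed
  then have "\<forall>\<^sub>F s in at_right 0. \<forall>\<omega>. S a $ \<omega> - S (q + s *\<^sub>R e) $ \<omega> < b"
    by (intro eventually_all_finite)
  moreover have "\<forall>\<^sub>F s in at_right 0. q + s *\<^sub>R e \<in> interior belief_set"
    using q by (intro eventually_along_line) auto
  moreover have "\<forall>\<^sub>F s in at_right 0. expected_score S p (q + s *\<^sub>R e) > expected_score S p q"
  proof (rule eventually_increasing_along)
    show "(expected_score S p has_derivative
        (\<lambda>h. (\<Sum>\<omega>\<in>UNIV. joint_prob p $ \<omega> *\<^sub>R g \<omega>) \<bullet> h)) (at q)"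
      unfolding expected_score_sum[abs_def] inner_sum_left inner_scaleR_left
      by (intro has_derivative_sum has_derivative_mult_right g)
    show "(\<Sum>\<omega>\<in>UNIV. joint_prob p $ \<omega> *\<^sub>R g \<omega>) \<bullet> e > 0"
      using neg by (simp add: inner_sum_left)
  qed
  ultimately have "\<forall>\<^sub>F s in at_right 0. (\<forall>\<omega>. S a $ \<omega> - S (q + s *\<^sub>R e) $ \<omega> < b) \<and>
      q + s *\<^sub>R e \<in> interior belief_set \<and> expected_score S p (q + s *\<^sub>R e) > expected_score S p q"
    by eventually_elim blast
  then obtain r where r: "r \<in> interior belief_set" "\<And>\<omega>. S a $ \<omega> - S r $ \<omega> < b"
     "expected_score S p r > expected_score S p q"
    using eventually_happens'[OF trivial_limit_at_right_real] by (metis (no_types, lifting))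
  have "a - p = (1 + t) *\<^sub>R (q - p)" by (simp add: a_def algebra_simps)
  then have "p \<noteq> a" using \<open>p \<noteq> q\<close> t(1) by auto
  \<comment> \<open>The weight comes from solving \<open>a = q + t (q - p)\<close> for
    \<open>q\<close>.\<close>
  moreover have "q = (t / (1 + t)) *\<^sub>R p + (1 - t / (1 + t)) *\<^sub>R a"
  proof -
    have t': "(1 + t) * (t / (1 + t)) = t" "(1 + t) * (1 - t / (1 + t)) = 1"
      using t(1) by (auto simp: field_simps)
    have "(1 + t) *\<^sub>R ((t / (1 + t)) *\<^sub>R p + (1 - t / (1 + t)) *\<^sub>R a) = t *\<^sub>R p + a"
      by (simp only: scaleR_add_right[of "1 + t"] scaleR_scaleR t' scaleR_one)
    also have "\<dots> = (1 + t) *\<^sub>R q" by (simp add: a_def algebra_simps)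
    finally show ?thesis using t(1) by (metis add_pos_pos less_irrefl scaleR_left_imp_eq zero_less_one)
  qed
  moreover have "natural_budget S a r \<le> natural_budget S a q"
    using r(2) by (auto simp: natural_budget_le_iff b_def intro: less_imp_le)
  ultimately have "expected_score S p r \<le> expected_score S p q"
    using t(1) by (intro optimal_on_ray[OF t(2)[folded a_def] p _ _ _ _ interior_belief_setD[OF r(1)]]) auto
  then show False using r(3) by simp
qed

text \<open>Where \<open>v\<close> is the only minimizing gradient, the first-order condition
  applies to every slight tilt towards \<open>v\<close> of a vector orthogonal to \<open>v\<close>.
  Both signs of that vector are allowed, so the orthogonal derivative vanishes.\<close>

lemma gradients_parallel:
  fixes g :: "outcome \<Rightarrow> real \<times> real"
  assumes q: "q \<in> interior belief_set"
    and g: "\<And>\<omega>. ((\<lambda>r. S r $ \<omega>) has_derivative (\<lambda>h. g \<omega> \<bullet> h)) (at q)"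
  obtains v c where "\<And>\<omega>. g \<omega> = c \<omega> *\<^sub>R v"
proof -
  have "finite (range (\<lambda>\<omega>. norm (g \<omega>)))" by simp
  then have "Max (range (\<lambda>\<omega>. norm (g \<omega>))) \<in> range (\<lambda>\<omega>. norm (g \<omega>))"
    by (intro Max_in) auto
  then obtain \<omega>0 where \<omega>0: "Max (range (\<lambda>\<omega>. norm (g \<omega>))) = norm (g \<omega>0)" by (elim imageE) blast
  define v where "v = g \<omega>0"
  have le: "norm (g \<omega>) \<le> norm v" for \<omega>
    using \<omega>0 Max_ge[of "range (\<lambda>\<omega>. norm (g \<omega>))" "norm (g \<omega>)"] by (simp add: v_def)
  show thesis
  proof (cases "v = 0")
    case True
    then show thesis using le by (intro that[of "\<lambda>_. 0" v]) auto
  next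
    case False
    \<comment> \<open>A quarter turn of \<open>v\<close>, spanning its orthogonal
      complement.\<close>
    define w where "w = (- snd v, fst v)"
    \<comment> \<open>Interior beliefs other than \<open>q\<close> at which \<open>v\<close> is the
      only minimizing gradient. Gradients rather than outcomes are compared, since several outcomes
      may share \<open>v\<close>.\<close>
    define U where "U = interior belief_set \<inter>
       (\<Inter>\<omega>\<in>{\<omega>. g \<omega> \<noteq> v}. {p. v \<bullet> (p - q) < g \<omega> \<bullet> (p - q)}) - {q}"
    have "open U"
      unfolding U_def
      by (intro open_delete open_Int open_INT ballI open_Collect_less continuous_intros) auto
    obtain p0 where p0: "p0 \<in> U"
    proof -
      have "\<forall>\<^sub>F t in at_right 0. q + t *\<^sub>R (- v) \<in> interior belief_set \<and> (0::real) < t"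
        using eventually_along_line[OF _ q, of "-v"] eventually_at_right_less[of "0::real"]
        by (simp add: eventually_conj_iff)
      then obtain t :: real where t: "q + t *\<^sub>R (- v) \<in> interior belief_set" "0 < t"
        using eventually_happens'[OF trivial_limit_at_right_real] by blast
      \<comment> \<open>Expanding the squared distance of \<open>g \<omega>\<close> and
        \<open>v\<close>, where \<open>v\<close> is longest.\<close>
      have "g \<omega> \<bullet> v < v \<bullet> v" if "g \<omega> \<noteq> v" for \<omega>
      proof -
        have "(g \<omega> - v) \<bullet> (g \<omega> - v) > 0" using that by simp
        moreover have "g \<omega> \<bullet> g \<omega> \<le> v \<bullet> v" using le[of \<omega>] by (simp add: norm_le)
        ultimately show ?thesis by (simp add: inner_diff inner_commute)
      qed
      then have "q + t *\<^sub>R (- v) \<in> U" using t False by (simp add: U_def)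
      then show ?thesis using that by blast
    qed
    \<comment> \<open>The derivative at \<open>q\<close>, in direction \<open>u\<close>, of the
      expected score under \<open>p\<close>.\<close>
    define F where "F p u = (\<Sum>\<omega>\<in>UNIV. joint_prob p $ \<omega> * (g \<omega> \<bullet> u))" for p u
    have F_add: "F p (x + r *\<^sub>R y) = F p x + r * F p y" for p x y r
      by (simp add: F_def inner_add_right ring_distribs sum.distrib sum_distrib_left mult.left_commute)
    have F_le: "F p u \<le> 0" if "p \<in> U" "u \<bullet> v = 0" for p u
    proof (rule ccontr)
      assume "\<not> F p u \<le> 0"
      \<comment> \<open>Small enough that the tilt changes the derivative by less than
        \<open>F p u\<close>.\<close>
      define \<delta> where "\<delta> = F p u / (\<bar>F p v\<bar> + 1)"
      have "\<delta> > 0" using \<open>\<not> F p u \<le> 0\<close> by (simp add: \<delta>_def)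
      have "g \<omega> \<bullet> (u + \<delta> *\<^sub>R v) > 0" if "\<And>\<omega>'. g \<omega> \<bullet> (p - q) \<le> g \<omega>' \<bullet> (p - q)" for \<omega>
      proof -
        have "g \<omega> = v"
          using that[of \<omega>0] \<open>p \<in> U\<close> by (force simp: U_def v_def)
        then show ?thesis
          using \<open>u \<bullet> v = 0\<close> \<open>\<delta> > 0\<close> False by (simp add: inner_add_right inner_commute)
      qed
      then have "F p (u + \<delta> *\<^sub>R v) \<le> 0"
        unfolding F_def using \<open>p \<in> U\<close> by (intro first_order_condition[OF q _ _ g]) (auto simp: U_def)
      moreover have "\<delta> * (\<bar>F p v\<bar> + 1) = F p u" by (simp add: \<delta>_def)
      moreover have "\<delta> * F p v \<ge> - (\<delta> * \<bar>F p v\<bar>)"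
        using \<open>\<delta> > 0\<close> mult_left_mono[of "- \<bar>F p v\<bar>" "F p v" \<delta>] by simp
      ultimately show False using \<open>\<delta> > 0\<close> by (simp add: F_add ring_distribs)
    qed
    have F_0: "F p w = 0" if "p \<in> U" for p
    proof -
      have "F p (- w) = - F p w" by (simp add: F_def sum_negf)
      moreover have "w \<bullet> v = 0" by (simp add: w_def inner_prod_def)
      ultimately show ?thesis
        using F_le[OF that, of w] F_le[OF that, of "- w"] by simp
    qed
    obtain \<epsilon> where \<epsilon>: "\<epsilon> > 0" "ball p0 \<epsilon> \<subseteq> U"
      using \<open>open U\<close> p0 open_contains_ball by blast
    define h where "h = \<epsilon> / 3"
    \<comment> \<open>\<open>F p w = 0\<close> as a polynomial in the coordinates of
      \<open>p\<close>; its coefficients determine the products of all four gradients with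
      \<open>w\<close>.\<close>
    have zero: "g BR \<bullet> w + (g TR \<bullet> w - g BR \<bullet> w) * (fst p0 + s) + (g BL \<bullet> w - g BR \<bullet> w) * (snd p0 + t)
        + (g TL \<bullet> w - g TR \<bullet> w - g BL \<bullet> w + g BR \<bullet> w) * ((fst p0 + s) * (snd p0 + t)) = 0"
      if "s \<in> {0, h}" "t \<in> {0, h}" for s t
    proof -
      have "norm (s, t) \<le> \<bar>s\<bar> + \<bar>t\<bar>"
        using norm_Pair_le[of s t] by simp
      also have "\<dots> < \<epsilon>" using that \<epsilon> by (auto simp: h_def)
      finally have "p0 + (s, t) \<in> ball p0 \<epsilon>"
        by (simp add: dist_norm norm_Pair)
      then have "p0 + (s, t) \<in> U" using \<epsilon>(2) by blast
      from F_0[OF this] show ?thesis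
        by (simp add: F_def sum_outcome joint_prob_nth algebra_simps)
    qed
    have "h \<noteq> 0" using \<epsilon> by (simp add: h_def)
    note b = bilinear_eq_0[OF this zero]
    have "g \<omega> \<bullet> w = 0" for \<omega> using b by (cases \<omega>) auto
    then have *: "fst (g \<omega>) * snd v = snd (g \<omega>) * fst v" for \<omega>
      by (simp add: w_def inner_prod_def algebra_simps)
    have vv: "v \<bullet> v \<noteq> 0" using False by simp
    show thesis
    proof (rule that)
      fix \<omega>
      \<comment> \<open>In the plane, a vector orthogonal to \<open>w\<close> equals its projection
        onto \<open>v\<close>.\<close>
      have "(v \<bullet> v) *\<^sub>R g \<omega> = (g \<omega> \<bullet> v) *\<^sub>R v"
        using *[of \<omega>] by (simp add: prod_eq_iff inner_prod_def) algebra
      then have "g \<omega> = (inverse (v \<bullet> v) * (g \<omega> \<bullet> v)) *\<^sub>R v"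
        using vv by (metis scaleR_scaleR left_inverse scaleR_one)
      then show "g \<omega> = (\<lambda>\<omega>. inverse (v \<bullet> v) * (g \<omega> \<bullet> v)) \<omega> *\<^sub>R v" .
    qed
  qed
qed

section \<open>The line through \<open>q\<close> orthogonal to the gradients\<close>

text \<open>If some coefficient is negative, the minimizing outcomes on this side of the line all
  have negative coefficients, so \<open>- v\<close> is an admissible direction in the first-order
  condition.\<close>

lemma weighted_coefficients_nonneg:
  assumes q: "q \<in> interior belief_set" and p: "p \<in> interior belief_set"
    and g: "\<And>\<omega>. ((\<lambda>r. S r $ \<omega>) has_derivative (\<lambda>h. (c \<omega> *\<^sub>R v) \<bullet> h)) (at q)"
    and pos: "v \<bullet> (p - q) > 0"
  shows "(\<Sum>\<omega>\<in>UNIV. joint_prob p $ \<omega> * c \<omega>) \<ge> 0"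
proof (cases "\<forall>\<omega>. c \<omega> \<ge> 0")
  case True
  then show ?thesis
    by (intro sum_nonneg mult_nonneg_nonneg joint_prob_nonneg interior_belief_setD p) auto
next
  case False
  then obtain \<omega>1 where \<omega>1: "c \<omega>1 < 0" by (auto simp: not_le)
  have "v \<noteq> 0" using pos by auto
  then have vv: "v \<bullet> v > 0" by simp
  have "(\<Sum>\<omega>\<in>UNIV. joint_prob p $ \<omega> * ((c \<omega> *\<^sub>R v) \<bullet> (- v))) \<le> 0"
  proof (rule first_order_condition[OF q p _ g])
    show "p \<noteq> q" using pos by auto
    fix \<omega>
    assume "\<And>\<omega>'. (c \<omega> *\<^sub>R v) \<bullet> (p - q) \<le> (c \<omega>' *\<^sub>R v) \<bullet> (p - q)"
    then have "c \<omega> * (v \<bullet> (p - q)) \<le> c \<omega>1 * (v \<bullet> (p - q))" by simp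
    then have "c \<omega> < 0" using pos \<omega>1 by (simp add: mult_le_cancel_right)
    then show "(c \<omega> *\<^sub>R v) \<bullet> (- v) > 0" using vv by (simp add: mult_neg_pos)
  qed
  then have "(\<Sum>\<omega>\<in>UNIV. joint_prob p $ \<omega> * c \<omega>) * (v \<bullet> v) \<ge> 0"
    by (simp add: sum_distrib_right sum_negf mult.assoc)
  then show ?thesis using vv by (simp add: zero_le_mult_iff)
qed

lemma weighted_coefficients_eq_0:
  assumes q: "q \<in> interior belief_set" and p: "p \<in> belief_set"
    and g: "\<And>\<omega>. ((\<lambda>r. S r $ \<omega>) has_derivative (\<lambda>h. (c \<omega> *\<^sub>R v) \<bullet> h)) (at q)"
    and "v \<noteq> 0" and orth: "v \<bullet> (p - q) = 0"
  shows "(\<Sum>\<omega>\<in>UNIV. joint_prob p $ \<omega> * c \<omega>) = 0"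
proof -
  have ge: "(\<Sum>\<omega>\<in>UNIV. joint_prob p $ \<omega> * c \<omega>) \<ge> 0"
    if g: "\<And>\<omega>. ((\<lambda>r. S r $ \<omega>) has_derivative (\<lambda>h. (c \<omega> *\<^sub>R v) \<bullet> h)) (at q)"
      and "v \<noteq> 0" and orth: "v \<bullet> (p - q) = 0" for c v
  proof -
    have "\<forall>\<^sub>F t in at_right 0. q + t *\<^sub>R v \<in> interior belief_set \<and> (0::real) < t"
      using eventually_along_line[OF _ q, of v] eventually_at_right_less[of "0::real"]
      by (simp add: eventually_conj_iff)
    then obtain \<delta> :: real where \<delta>: "q + \<delta> *\<^sub>R v \<in> interior belief_set" "0 < \<delta>"
      using eventually_happens'[OF trivial_limit_at_right_real] by blast
    \<comment> \<open>This segment reaches \<open>p\<close> from the positive side and, for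
      \<open>t\<close> in \<open>(0, 1)\<close>, stays in the interior even when \<open>p\<close> is
      a boundary point.\<close>
    define l where "l t = (1 - t) *\<^sub>R p + (1 - (1 - t)) *\<^sub>R (q + \<delta> *\<^sub>R v)" for t
    have "((\<lambda>t. \<Sum>\<omega>\<in>UNIV. joint_prob (l t) $ \<omega> * c \<omega>) \<longlongrightarrow>
       (\<Sum>\<omega>\<in>UNIV. joint_prob (l 0) $ \<omega> * c \<omega>)) (at_right 0)"
      unfolding sum_outcome joint_prob_nth l_def by (intro tendsto_intros)
    moreover have "\<forall>\<^sub>F t::real in at_right 0. t \<in> {0<..<1}"
      by (rule eventually_at_right_real) simp
    then have "\<forall>\<^sub>F t in at_right 0. (\<Sum>\<omega>\<in>UNIV. joint_prob (l t) $ \<omega> * c \<omega>) \<ge> 0"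
    proof eventually_elim
      case (elim t)
      have "l t - q = (1 - t) *\<^sub>R (p - q) + (t * \<delta>) *\<^sub>R v"
        by (simp add: l_def algebra_simps)
      then have "v \<bullet> (l t - q) = t * \<delta> * (v \<bullet> v)"
        using orth by (simp add: inner_add_right)
      then have "v \<bullet> (l t - q) > 0" using elim \<delta> \<open>v \<noteq> 0\<close> by simp
      moreover have "l t \<in> interior belief_set"
        unfolding l_def using elim by (intro mix_in_interior_belief_set p \<delta>) auto
      ultimately show ?case by (intro weighted_coefficients_nonneg[OF q _ g])
    qed
    ultimately have "0 \<le> (\<Sum>\<omega>\<in>UNIV. joint_prob (l 0) $ \<omega> * c \<omega>)"
      by (intro tendsto_lowerbound[of _ _ "at_right (0::real)" 0]) auto
    then show ?thesis by (simp add: l_def)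
  qed
  \<comment> \<open>Negating both \<open>c\<close> and \<open>v\<close> keeps the gradients but
    exchanges the sides of the line, which gives the reverse inequality.\<close>
  from ge[OF g \<open>v \<noteq> 0\<close> orth] ge[of "\<lambda>\<omega>. - c \<omega>" "- v"] g assms(4) orth show ?thesis
    by (simp add: sum_negf)
qed

text \<open>A higher score at \<open>z\<close> would persist at a point \<open>y\<close> slightly
  shifted against the gradient. Towards \<open>y\<close> the score first falls below its value at
  \<open>q\<close>, against quasiconcavity.\<close>

lemma score_le_on_tangent:
  assumes q: "q \<in> interior belief_set" and z: "z \<in> interior belief_set"
    and g: "((\<lambda>r. S r $ \<omega>) has_derivative (\<lambda>h. g \<bullet> h)) (at q)"
    and "g \<noteq> 0" and orth: "g \<bullet> (z - q) = 0"
  shows "S z $ \<omega> \<le> S q $ \<omega>"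
proof (rule ccontr)
  assume gt: "\<not> ?thesis"
  have "((\<lambda>t. z + t *\<^sub>R (- g)) \<longlongrightarrow> z + 0 *\<^sub>R (- g)) (at_right 0)"
    by (intro tendsto_intros)
  then have "((\<lambda>t. S (z + t *\<^sub>R (- g))) \<longlongrightarrow> S z) (at_right 0)"
    by (intro isCont_tendsto_compose[OF isCont_S[OF z]]) simp
  then have "((\<lambda>t. S (z + t *\<^sub>R (- g)) $ \<omega>) \<longlongrightarrow> S z $ \<omega>) (at_right 0)"
    by (rule tendsto_vec_nth)
  then have "\<forall>\<^sub>F t in at_right 0. S (z + t *\<^sub>R (- g)) $ \<omega> > S q $ \<omega>"
    by (rule order_tendstoD) (use gt in simp)
  moreover have "\<forall>\<^sub>F t::real in at_right 0. z + t *\<^sub>R (- g) \<in> interior belief_set"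
    using z by (intro eventually_along_line) auto
  moreover have "\<forall>\<^sub>F t::real in at_right 0. t > 0"
    by (rule eventually_at_right_less)
  ultimately have "\<forall>\<^sub>F t in at_right 0. S (z + t *\<^sub>R (- g)) $ \<omega> > S q $ \<omega> \<and>
      z + t *\<^sub>R (- g) \<in> interior belief_set \<and> t > 0"
    by eventually_elim blast
  then obtain t where t: "S (z + t *\<^sub>R (- g)) $ \<omega> > S q $ \<omega>"
      "z + t *\<^sub>R (- g) \<in> interior belief_set" "t > 0"
    using eventually_happens'[OF trivial_limit_at_right_real] by blast
  define y where "y = z + t *\<^sub>R (- g)"
  define l where "l u = u *\<^sub>R y + (1 - u) *\<^sub>R q" for u
  have "g \<bullet> (y - q) = g \<bullet> (z - q) - t * (g \<bullet> g)"
    by (simp add: y_def inner_diff_right inner_add_right)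
  then have "(- g) \<bullet> (y - q) > 0" using orth t(3) \<open>g \<noteq> 0\<close> by simp
  moreover have "((\<lambda>r. - S r $ \<omega>) has_derivative (\<lambda>h. (- g) \<bullet> h)) (at q)"
    using has_derivative_minus[OF g] by simp
  ultimately have ev: "\<forall>\<^sub>F u in at_right 0. S (l u) $ \<omega> < S q $ \<omega>"
    using eventually_increasing_along[of "\<lambda>r. - S r $ \<omega>" "- g" q "y - q"]
    by (simp add: l_def algebra_simps)
  txt \<open>Quasiconcavity is only given for midpoints, so \<open>q\<close> is approached by repeated halving.\<close>
  have "S q $ \<omega> \<le> S (l ((1/2) ^ n)) $ \<omega>" for n
  proof (induction n)
    case 0
    then show ?case using t by (simp add: l_def y_def)
  next
    case (Suc n)
    have "l ((1/2) ^ n) \<in> belief_set"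
      unfolding l_def using q t(2)
      by (intro mix_in_belief_set interior_belief_setD) (auto simp: y_def power_le_one)
    moreover have "l ((1/2) ^ Suc n) = (1/2) *\<^sub>R l ((1/2) ^ n) + (1/2) *\<^sub>R q"
      by (simp add: l_def algebra_simps flip: scaleR_add_left)
    ultimately show ?case
      using quasiconcave(1)[of "l ((1/2) ^ n)" q \<omega>] Suc interior_belief_setD[OF q] by simp
  qed
  moreover have "filterlim (\<lambda>n. (1/2) ^ n :: real) (at_right 0) sequentially"
    by (intro tendsto_imp_filterlim_at_right LIMSEQ_power_zero) auto
  from eventually_happens'[OF _ eventually_compose_filterlim[OF ev this]]
  obtain n where "S (l ((1/2) ^ n)) $ \<omega> < S q $ \<omega>" by auto
  ultimately show False by (meson not_le)
qed

end

section \<open>Boundary points of the square\<close>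

lemma ray_exit:
  assumes "q \<in> interior belief_set" "d \<noteq> 0"
  obtains s where "s > 0" "q + s *\<^sub>R d \<in> belief_set" "q + s *\<^sub>R d \<notin> interior belief_set"
proof -
  have "compact belief_set" by (simp add: belief_set_def compact_Times)
  then show ?thesis
    using ray_to_frontier[OF compact_imp_bounded assms] that
    by (metis DiffE closure_closed compact_imp_closed frontier_def)
qed

text \<open>At most two outcomes are possible at a boundary belief, so if one has coefficient zero,
  the vanishing expectation forces the other to be zero.\<close>

lemma edge_coefficients_eq_0:
  assumes p: "p \<in> belief_set" "p \<notin> interior belief_set"
    and sum0: "(\<Sum>\<omega>\<in>UNIV. joint_prob p $ \<omega> * c \<omega>) = 0"
    and \<omega>: "joint_prob p $ \<omega> \<noteq> 0" "c \<omega> = 0" and \<omega>': "joint_prob p $ \<omega>' \<noteq> 0"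
  shows "c \<omega>' = 0"
proof -
  have "p \<notin> {0<..<1} \<times> {0<..<1}"
    using p(2) interior_belief_set by simp
  then have "fst p = 0 \<or> fst p = 1 \<or> snd p = 0 \<or> snd p = 1"
    using p(1) by (auto simp: belief_set_def)
  then show ?thesis
    using sum0 \<omega> \<omega>' by (cases \<omega>; cases \<omega>') (auto simp: sum_outcome joint_prob_nth)
qed

text \<open>Two distinct outcomes with a common component are both impossible only on the line
  through a side of the square, two opposite outcomes only at two opposite corners. So
  \<open>q\<close> would lie on such a line or on a diagonal.\<close>

lemma opposite_supports_cover:
  assumes q: "q \<in> interior belief_set" "fst q \<noteq> snd q" "fst q + snd q \<noteq> 1"
    and l: "q = l *\<^sub>R p + (1 - l) *\<^sub>R p'"
    and "joint_prob p $ \<omega> = 0" "joint_prob p' $ \<omega> = 0"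
    and "joint_prob p $ \<omega>' = 0" "joint_prob p' $ \<omega>' = 0"
  shows "\<omega> = \<omega>'"
proof -
  have "fst q = l * fst p + (1 - l) * fst p'" "snd q = l * snd p + (1 - l) * snd p'"
    using l by simp_all
  moreover have "0 < fst q" "fst q < 1" "0 < snd q" "snd q < 1"
    using q by (auto simp: interior_belief_set)
  ultimately show ?thesis
    using assms(2,3,5-) by (cases \<omega>; cases \<omega>') (auto simp: joint_prob_nth)
qed

section \<open>Vanishing derivative and contradiction\<close>

context truthful_rule
begin

lemma gradient_eq_0:
  fixes g :: "outcome \<Rightarrow> real \<times> real"
  assumes q: "q \<in> interior belief_set" "fst q \<noteq> snd q" "fst q + snd q \<noteq> 1"
    and g: "\<And>\<omega>. ((\<lambda>r. S r $ \<omega>) has_derivative (\<lambda>h. g \<omega> \<bullet> h)) (at q)"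
  shows "g \<omega> = 0"
proof (rule ccontr)
  assume "g \<omega> \<noteq> 0"
  obtain v c where gc: "\<And>\<omega>. g \<omega> = c \<omega> *\<^sub>R v"
    using gradients_parallel[OF q(1) g] by blast
  then have "v \<noteq> 0" "c \<omega> \<noteq> 0" using \<open>g \<omega> \<noteq> 0\<close> by auto
  define d where "d = (- snd v, fst v)"
  have "d \<noteq> 0" using \<open>v \<noteq> 0\<close> by (auto simp: d_def prod_eq_iff)
  have vd: "v \<bullet> d = 0" by (simp add: d_def inner_prod_def)
  note sum0 = weighted_coefficients_eq_0[OF q(1) _ g[unfolded gc] \<open>v \<noteq> 0\<close>]
  have no_exit: "\<exists>\<omega>. joint_prob p $ \<omega> \<noteq> 0 \<and> c \<omega> = 0"
    if p: "p \<in> belief_set" "p \<notin> interior belief_set" and orth: "v \<bullet> (p - q) = 0" for p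
  proof (rule ccontr)
    assume *: "\<not> ?thesis"
    have "p \<noteq> q" using p q by auto
    then obtain t where t: "0 < t" "t < 1"
       "expected_score S p q < expected_score S p (t *\<^sub>R p + (1 - t) *\<^sub>R q)"
      using better_on_segment p(1) interior_belief_setD[OF q(1)] by blast
    define z where "z = t *\<^sub>R p + (1 - t) *\<^sub>R q"
    have z: "z \<in> interior belief_set"
      unfolding z_def using t by (intro mix_in_interior_belief_set p q) auto
    have "z - q = t *\<^sub>R (p - q)" by (simp add: z_def algebra_simps)
    then have "v \<bullet> (z - q) = 0" using orth by simp
    then have "S z $ \<omega> \<le> S q $ \<omega>" if "joint_prob p $ \<omega> \<noteq> 0" for \<omega>
      using that * \<open>v \<noteq> 0\<close> gc[of \<omega>]
      by (intro score_le_on_tangent[OF q(1) z g]) auto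
    then have "joint_prob p $ \<omega> * S z $ \<omega> \<le> joint_prob p $ \<omega> * S q $ \<omega>" for \<omega>
      using joint_prob_nonneg[OF p(1), of \<omega>] by (cases "joint_prob p $ \<omega> = 0") (auto intro: mult_left_mono)
    then have "expected_score S p z \<le> expected_score S p q"
      unfolding expected_score_sum by (intro sum_mono) auto
    then show False using t by (simp add: z_def)
  qed
  \<comment> \<open>One possible outcome with zero coefficient makes the coefficients of all
    possible outcomes zero, so nonzero coefficients belong to impossible outcomes.\<close>
  have exit_zero: "joint_prob p $ \<omega> = 0"
    if p: "p \<in> belief_set" "p \<notin> interior belief_set" "v \<bullet> (p - q) = 0" and "c \<omega> \<noteq> 0" for p \<omega>
    using edge_coefficients_eq_0[OF p(1,2) sum0[OF p(1,3)]] no_exit[OF p] \<open>c \<omega> \<noteq> 0\<close> by blast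
  obtain s where s: "s > 0" "q + s *\<^sub>R d \<in> belief_set" "q + s *\<^sub>R d \<notin> interior belief_set"
    using ray_exit[OF q(1) \<open>d \<noteq> 0\<close>] by blast
  obtain s' where s': "s' > 0" "q + s' *\<^sub>R (- d) \<in> belief_set" "q + s' *\<^sub>R (- d) \<notin> interior belief_set"
    using ray_exit[OF q(1), of "- d"] \<open>d \<noteq> 0\<close> by auto
  have zero: "joint_prob (q + s *\<^sub>R d) $ \<omega> = 0" "joint_prob (q + s' *\<^sub>R (- d)) $ \<omega> = 0" if "c \<omega> \<noteq> 0" for \<omega>
    using that s s' vd by (auto intro!: exit_zero simp del: scaleR_minus_right)
  define l where "l = s' / (s + s')"
  have "(s + s') *\<^sub>R (l *\<^sub>R (q + s *\<^sub>R d) + (1 - l) *\<^sub>R (q + s' *\<^sub>R (- d)))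
      = (s + s') *\<^sub>R q"
  proof -
    have l': "(s + s') * l = s'" "(s + s') * (1 - l) = s"
      using s(1) s'(1) by (auto simp: l_def field_simps)
    have "(s + s') *\<^sub>R (l *\<^sub>R (q + s *\<^sub>R d) + (1 - l) *\<^sub>R (q + s' *\<^sub>R (- d)))
        = s' *\<^sub>R (q + s *\<^sub>R d) + s *\<^sub>R (q + s' *\<^sub>R (- d))"
      by (simp only: scaleR_add_right[of "s + s'"] scaleR_scaleR l')
    also have "\<dots> = (s + s') *\<^sub>R q" by (simp add: algebra_simps)
    finally show ?thesis .
  qed
  then have "q = l *\<^sub>R (q + s *\<^sub>R d) + (1 - l) *\<^sub>R (q + s' *\<^sub>R (- d))"
    using s(1) s'(1) by (metis add_pos_pos less_irrefl scaleR_left_imp_eq)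
  from opposite_supports_cover[OF q this zero zero]
  have unique: "\<omega>' = \<omega>" if "c \<omega>' \<noteq> 0" for \<omega>'
    using that \<open>c \<omega> \<noteq> 0\<close> by blast
  \<comment> \<open>The belief \<open>q\<close> is itself on the line, and only one term of its
    vanishing expectation survives.\<close>
  have "(\<Sum>\<omega>'\<in>UNIV. joint_prob q $ \<omega>' * c \<omega>') = (\<Sum>\<omega>'\<in>{\<omega>}. joint_prob q $ \<omega>' * c \<omega>')"
    using unique by (intro sum.mono_neutral_right) auto
  then have "joint_prob q $ \<omega> * c \<omega> = 0"
    using sum0[OF interior_belief_setD[OF q(1)]] by simp
  then show False using joint_prob_pos[OF q(1), of \<omega>] \<open>c \<omega> \<noteq> 0\<close> by simp
qed

lemma has_derivative_0:
  assumes q: "q \<in> interior belief_set" "fst q \<noteq> snd q" "fst q + snd q \<noteq> 1"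
  shows "(S has_derivative (\<lambda>h. 0)) (at q)"
proof -
  have "S differentiable (at q)"
    using technical q(1) unfolding technical_conditions_def
    by (auto simp: differentiable_on_eq_differentiable_at)
  then obtain D where D: "(S has_derivative D) (at q)"
    by (auto simp: differentiable_def)
  \<comment> \<open>The gradient representing the derivative of a component by inner
    products.\<close>
  define g where "g \<omega> = adjoint (\<lambda>h. D h $ \<omega>) 1" for \<omega>
  have comp: "((\<lambda>r. S r $ \<omega>) has_derivative (\<lambda>h. D h $ \<omega>)) (at q)" for \<omega>
    by (rule bounded_linear.has_derivative[OF bounded_linear_vec_nth D])
  have "g \<omega> \<bullet> h = D h $ \<omega>" for \<omega> h
    using adjoint_works[OF has_derivative_linear[OF comp[of \<omega>]], of h 1]
    by (simp add: g_def inner_commute)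
  then have "D h $ \<omega> = 0" for h \<omega>
    using gradient_eq_0[OF q, of g] comp by (metis (no_types, lifting) ext inner_zero_left)
  then have "D = (\<lambda>h. 0)" by (simp add: fun_eq_iff vec_eq_iff)
  with D show ?thesis by simp
qed

lemma inconsistent: False
proof -
  \<comment> \<open>At height 1/2 both diagonals are met only at first coordinate 1/2, which this
    segment avoids.\<close>
  let ?A = "{1/8..3/8} \<times> {1/2} :: (real \<times> real) set"
  have "(S has_derivative (\<lambda>h. 0)) (at q within ?A)" if "q \<in> ?A" for q
  proof (rule has_derivative_at_withinI, rule has_derivative_0)
    show "q \<in> interior belief_set" "fst q \<noteq> snd q" "fst q + snd q \<noteq> 1"
      using that by (auto simp: interior_belief_set)
  qed
  then obtain k where k: "\<And>q. q \<in> ?A \<Longrightarrow> S q = k"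
    using has_derivative_zero_constant[of ?A S] by (metis convex_Times convex_real_interval(5) convex_singleton)
  have "expected_score S (1/8, 1/2) (3/8, 1/2) < expected_score S (1/8, 1/2) (1/8, 1/2)"
    by (rule strictly_proper) (auto simp: belief_set_def)
  moreover have "S (1/8, 1/2) = k" "S (3/8, 1/2) = k"
    by (intro k; simp)+
  ultimately show False by (simp add: expected_score_def)
qed

end

theorem theorem10:
  shows "\<not> (\<exists>S :: scoring_rule. technical_conditions S \<and> budget_constrained_truthful S)"
proof
  assume "\<exists>S :: scoring_rule. technical_conditions S \<and> budget_constrained_truthful S"
  then obtain S where "truthful_rule S"
    by (auto simp: truthful_rule_def)
  then show False
    by (rule truthful_rule.inconsistent)
qed

end
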